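(* Let $q$ be a prime power, $n\ge3$, $\sigma$ a generator of $\mathrm{Gal}(\mathbb{F}_{q^n}/\mathbb{F}_q)$, and $L=ax+bx^{\sigma}+cx^{\sigma^2}+dx^{\sigma^3}$ with $a,b,c,d\in\mathbb{F}_{q^n}$ and $abcd\neq0$. Then $P_L(y)=a+by+cy^{\sigma+1}+dy^{\sigma^2+\sigma+1}$ has $q^2+q+1$ roots in $\mathbb{F}_{q^n}$ if and only if $H_{n-1}=H_{n-2}=0$ and $H_n\in\mathbb{F}_q$.
   Context: Let $w=\frac{a^\sigma c}{b^{\sigma+1}}$ and $z=\frac{b^\sigma d}{c^{\sigma+1}}$. Define $H_0=1$, $H_1=-1$, $H_2=1-z$, and for $k\ge3$, $H_k=-H_{k-1}-z^{\sigma^{k-2}}H_{k-2}-w^{\sigma^{k-2}}z^{\sigma^{k-2}+\sigma^{k-3}}H_{k-3}$ (so e.g. $H_3=z^\sigma+z-1-w^\sigma z^{1+\sigma}$). *)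

theory Defs
  imports "HOL-Algebra.Algebra" "HOL-Algebra.Algebraic_Closure_Type" "HOL-Number_Theory.Prime_Powers"
begin

text \<open>
  The large field is a finite type of class \<open>field\<close>; \<open>ring_of_type_algebra\<close> is that field viewed
  as a ring record, so that the library predicates \<open>subfield\<close>, \<open>ring_iso\<close> and \<open>generate\<close> apply.
\<close>

definition galois_group :: "'a::field set \<Rightarrow> ('a \<Rightarrow> 'a) monoid" where
  "galois_group K =
     \<lparr>carrier = {\<tau> \<in> ring_iso ring_of_type_algebra ring_of_type_algebra. \<forall>x\<in>K. \<tau> x = x},
      monoid.mult = (\<circ>), one = id\<rparr>"

definition galois_generator :: "'a::field set \<Rightarrow> ('a \<Rightarrow> 'a) \<Rightarrow> bool" where
  "galois_generator K \<sigma> \<longleftrightarrow>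
     \<sigma> \<in> carrier (galois_group K) \<and>
     generate (galois_group K) {\<sigma>} = carrier (galois_group K)"

text \<open>
  Exponents are in the usual exponential notation for automorphisms: \<open>x\<close> to the power
  \<open>\<sigma>\<^sup>i + \<sigma>\<^sup>j\<close> means \<open>(\<sigma> ^^ i) x * (\<sigma> ^^ j) x\<close>.

  The polynomial \<open>P\<^sub>L\<close> is attached to the coefficients of the \<open>\<sigma>\<close>-polynomial
  \<open>L = a x + b \<sigma>(x) + c \<sigma>\<^sup>2(x) + d \<sigma>\<^sup>3(x)\<close> and not to the map that \<open>L\<close> induces: if \<open>\<sigma>\<^sup>3 = id\<close>,
  different coefficients can induce the same map.
\<close>

definition P_L :: "('a::field \<Rightarrow> 'a) \<Rightarrow> 'a \<Rightarrow> 'a \<Rightarrow> 'a \<Rightarrow> 'a \<Rightarrow> 'a \<Rightarrow> 'a" where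
  "P_L \<sigma> a b c d y =
     a + b * y + c * (\<sigma> y * y) + d * ((\<sigma> ^^ 2) y * \<sigma> y * y)"

definition w_param :: "('a::field \<Rightarrow> 'a) \<Rightarrow> 'a \<Rightarrow> 'a \<Rightarrow> 'a \<Rightarrow> 'a" where
  "w_param \<sigma> a b c = (\<sigma> a * c) / (\<sigma> b * b)"

definition z_param :: "('a::field \<Rightarrow> 'a) \<Rightarrow> 'a \<Rightarrow> 'a \<Rightarrow> 'a \<Rightarrow> 'a" where
  "z_param \<sigma> b c d = (\<sigma> b * d) / (\<sigma> c * c)"

text \<open>The last equation is the recursion for \<open>H\<^sub>k\<close> with \<open>k = j + 3\<close>.\<close>

fun H :: "('a::field \<Rightarrow> 'a) \<Rightarrow> 'a \<Rightarrow> 'a \<Rightarrow> nat \<Rightarrow> 'a" where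
  "H \<sigma> w z 0 = 1"
| "H \<sigma> w z (Suc 0) = - 1"
| "H \<sigma> w z (Suc (Suc 0)) = 1 - z"
| "H \<sigma> w z (Suc (Suc (Suc j))) =
     - H \<sigma> w z (Suc (Suc j))
     - (\<sigma> ^^ (j + 1)) z * H \<sigma> w z (Suc j)
     - (\<sigma> ^^ (j + 1)) w * ((\<sigma> ^^ (j + 1)) z * (\<sigma> ^^ j) z) * H \<sigma> w z j"

end

(*
  Put N(y) = y \<sigma>(y) ... \<sigma>^(n-1)(y). On a root y of P_L every partial norm y \<sigma>(y) ... \<sigma>^(k-1)(y)
  equals \<alpha>_k + \<beta>_k y + \<gamma>_k y \<sigma>(y), where \<alpha>, \<beta>, \<gamma> are the basic solutions of the linear
  recurrence with coefficients \<sigma>^k(a), ..., \<sigma>^k(d), and \<gamma>_(k+2) is H_k times a partial norm of c/d.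
  So the condition on H says \<gamma>_n = \<gamma>_(n+1) = 0 and \<gamma>_(n+2) \<in> K.

  If there are q^2+q+1 roots, some norm value \<kappa> \<in> K is taken at least q+2 times. By Hilbert 90 these
  roots are y = \<rho> \<sigma>(x)/x, so e0 + e1 y + e2 y \<sigma>(y) vanishing on all of them gives a \<sigma>-polynomial of
  \<sigma>-degree two with more than q^2 zeros, hence e0 = e1 = e2 = 0. Applied to the expressions for N(y),
  N(y) y and N(y) y \<sigma>(y) this determines \<gamma>_n, \<gamma>_(n+1) and \<gamma>_(n+2).

  Conversely \<alpha>_n = \<kappa> and \<beta>_n = \<gamma>_n = 0 for some \<kappa> \<in> K - {0}. Choose \<rho> of norm \<kappa> and twist L by \<rho>.
  Variation of constants yields a \<sigma>-polynomial Q of \<sigma>-degree n-3 with Q \<circ> L = 0, and counting makes the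
  kernel of the twisted L as large as possible, q^3. Its nonzero elements x, up to K - {0}, correspond
  to the roots \<rho> \<sigma>(x)/x.
*)
theory Submission
  imports Defs "HOL-Number_Theory.Residues"
begin

section \<open>Sigma-polynomials and Hilbert 90\<close>

lemma card_le_fibres:
  assumes "finite S" "f ` S \<subseteq> T" "finite T" "\<And>y. y \<in> T \<Longrightarrow> card {x \<in> S. f x = y} \<le> k"
  shows "card S \<le> card T * k"
proof -
  have "card S = (\<Sum>y\<in>T. card {x \<in> S. f x = y})"
    using sum.group[OF assms(1,3,2), of "\<lambda>_. 1::nat"] by simp
  also have "\<dots> \<le> of_nat (card T) * k"
    by (rule sum_bounded_above) (use assms(4) in auto)
  finally show ?thesis by simp
qed

lemma card_eq_fibres:
  assumes "finite S" "\<And>y. y \<in> f ` S \<Longrightarrow> card {x \<in> S. f x = y} = k"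
  shows "card S = card (f ` S) * k"
proof -
  have "card S = (\<Sum>y\<in>f ` S. card {x \<in> S. f x = y})"
    using sum.image_gen[OF assms(1), of "\<lambda>_. 1::nat" f] by simp
  also have "\<dots> = (\<Sum>y\<in>f ` S. k)"
    by (rule sum.cong) (use assms(2) in auto)
  finally show ?thesis by simp
qed

text \<open>Abel summation. If all \<open>A i\<close> up to \<open>Suc m\<close> sum to zero, the
  boundary term is the missing summand, and the full sum is expressed through differences of
  \<open>t\<close>.\<close>

lemma sum_by_parts:
  fixes A t :: "nat \<Rightarrow> 'a::comm_ring"
  shows "(\<Sum>i\<le>m. - (\<Sum>j\<le>i. A j) * (t (Suc i) - t i)) =
    (\<Sum>i\<le>m. A i * t i) - (\<Sum>i\<le>m. A i) * t (Suc m)"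
  by (induction m) (simp_all add: algebra_simps)

section \<open>Cyclic extensions and zeros of \<sigma>-polynomials\<close>

locale cyclic_extension =
  fixes \<sigma> :: "'a::{field,finite} \<Rightarrow> 'a" and K :: "'a set" and q n :: nat
  assumes add: "\<sigma> (x + y) = \<sigma> x + \<sigma> y"
    and mult: "\<sigma> (x * y) = \<sigma> x * \<sigma> y"
    and one: "\<sigma> 1 = 1"
    and fixed: "\<sigma> x = x \<longleftrightarrow> x \<in> K"
    and funpow_n: "(\<sigma> ^^ n) x = x"
    and card_K: "card K = q"
    and card_UNIV: "card (UNIV :: 'a set) = q ^ n"
begin

lemma sp_add: "(\<sigma> ^^ k) (x + y) = (\<sigma> ^^ k) x + (\<sigma> ^^ k) y"
  by (induction k) (simp_all add: add)

lemma sp_mult: "(\<sigma> ^^ k) (x * y) = (\<sigma> ^^ k) x * (\<sigma> ^^ k) y"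
  by (induction k) (simp_all add: mult)

lemma sp_one [simp]: "(\<sigma> ^^ k) 1 = 1"
  by (induction k) (simp_all add: one)

lemma sp_zero [simp]: "(\<sigma> ^^ k) 0 = 0"
  using sp_add[of k 0 0] by (metis add_0 add_cancel_right_left)

lemma sp_minus: "(\<sigma> ^^ k) (- x) = - (\<sigma> ^^ k) x"
  using sp_add[of k x "- x"] by (simp add: eq_neg_iff_add_eq_0 add.commute)

lemma sp_diff: "(\<sigma> ^^ k) (x - y) = (\<sigma> ^^ k) x - (\<sigma> ^^ k) y"
  using sp_add[of k x "- y"] by (simp add: sp_minus)

lemma sp_sum: "(\<sigma> ^^ k) (\<Sum>i\<in>I. f i) = (\<Sum>i\<in>I. (\<sigma> ^^ k) (f i))"
  by (induction I rule: infinite_finite_induct) (simp_all add: sp_add)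

lemma sp_eq_0_iff [simp]: "(\<sigma> ^^ k) x = 0 \<longleftrightarrow> x = 0"
proof
  assume "(\<sigma> ^^ k) x = 0"
  then have "(\<sigma> ^^ k) (x * inverse x) = 0" by (simp add: sp_mult)
  then show "x = 0" by (cases "x = 0") simp_all
qed simp

lemma sp_inverse: "(\<sigma> ^^ k) (inverse x) = inverse ((\<sigma> ^^ k) x)"
proof (cases "x = 0")
  case False
  then have "(\<sigma> ^^ k) x * (\<sigma> ^^ k) (inverse x) = 1"
    by (simp flip: sp_mult)
  then show ?thesis by (metis inverse_unique)
qed simp

lemma sp_divide: "(\<sigma> ^^ k) (x / y) = (\<sigma> ^^ k) x / (\<sigma> ^^ k) y"
  by (simp add: divide_inverse sp_mult sp_inverse)

lemma sp_sp: "(\<sigma> ^^ k) ((\<sigma> ^^ l) x) = (\<sigma> ^^ (k + l)) x"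
  by (simp add: funpow_add)

lemmas sp_simps = sp_add sp_mult sp_minus sp_diff sp_divide sp_sp

lemmas s_simps = sp_simps[of 1, simplified] sp_sum[of 1, simplified] sp_inverse[of 1, simplified]

lemma s_zero [simp]: "\<sigma> 0 = 0" and s_eq_0_iff [simp]: "\<sigma> x = 0 \<longleftrightarrow> x = 0"
  using sp_zero[of 1] sp_eq_0_iff[of 1] by simp_all

lemma zero_in_K: "0 \<in> K" and one_in_K: "1 \<in> K"
  by (simp_all add: fixed[symmetric] one s_simps)

lemma q_ge_2: "q \<ge> 2"
proof -
  have "card {0, 1 :: 'a} \<le> card K"
    by (rule card_mono) (use zero_in_K one_in_K in auto)
  then show ?thesis by (simp add: card_K)
qed

lemma K_mult: "x \<in> K \<Longrightarrow> y \<in> K \<Longrightarrow> x * y \<in> K"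
  and K_divide: "x \<in> K \<Longrightarrow> y \<in> K \<Longrightarrow> x / y \<in> K"
  by (simp_all add: fixed[symmetric] s_simps)

text \<open>The additive map \<open>\<sigma> x - x\<close> has kernel \<open>K\<close>, so a
  nonempty fibre lies in one coset of \<open>K\<close>.\<close>

lemma card_additive_fibre:
  "card {x. \<sigma> x - x = y} \<le> q"
proof (cases "{x. \<sigma> x - x = y} = {}")
  case False
  then obtain x where "\<sigma> x - x = y" by auto
  then have "{x. \<sigma> x - x = y} \<subseteq> (\<lambda>k. x + k) ` K"
  proof (intro subsetI)
    fix x' assume "x' \<in> {x. \<sigma> x - x = y}"
    then have "x' - x \<in> K"
      using \<open>\<sigma> x - x = y\<close> by (simp add: fixed[symmetric] s_simps algebra_simps)
    then show "x' \<in> (\<lambda>k. x + k) ` K" by (intro image_eqI[of _ _ "x' - x"]) auto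
  qed
  then have "card {x. \<sigma> x - x = y} \<le> card ((\<lambda>k. x + k) ` K)"
    by (intro card_mono) simp_all
  also have "\<dots> \<le> q" using card_image_le[of K] by (simp add: card_K)
  finally show ?thesis .
qed simp

text \<open>If \<open>x\<^sub>0\<close> is a nonzero root, substituting \<open>x = x\<^sub>0 t\<close> makes the coefficients sum to zero, and
  summation by parts then splits off \<open>\<sigma> - 1\<close> on the right.\<close>

lemma card_kernel_le:
  assumes "c m \<noteq> 0"
  shows "card {x. (\<Sum>i\<le>m. c i * (\<sigma> ^^ i) x) = 0} \<le> q ^ m"
  using assms
proof (induction m arbitrary: c)
  case 0
  then have "{x. (\<Sum>i\<le>0. c i * (\<sigma> ^^ i) x) = 0} = {0}" by auto
  then show ?case by simp
next
  case (Suc m)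
  let ?Z = "{x. (\<Sum>i\<le>Suc m. c i * (\<sigma> ^^ i) x) = 0}"
  show ?case
  proof (cases "\<exists>x0\<in>?Z. x0 \<noteq> 0")
    case False
    then have "?Z \<subseteq> {0}" by blast
    then have "card ?Z \<le> card {0 :: 'a}" by (intro card_mono) simp_all
    also have "\<dots> \<le> q ^ Suc m" using q_ge_2 by simp
    finally show ?thesis .
  next
    case True
    then obtain x0 where x0: "x0 \<in> ?Z" "x0 \<noteq> 0" by blast
    define A where "A i = c i * (\<sigma> ^^ i) x0" for i
    define e where "e i = - (\<Sum>j\<le>i. A j)" for i
    have A0: "(\<Sum>i\<le>Suc m. A i) = 0" using x0 by (simp add: A_def)
    \<comment> \<open>The \<open>A i\<close> sum to zero, so \<open>e m\<close> is the last of them.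
      It is nonzero because \<open>c (Suc m)\<close> and \<open>x0\<close> are, which makes the
      induction hypothesis applicable.\<close>
    have em: "e m = A (Suc m)"
      using A0 by (simp add: e_def neg_eq_iff_add_eq_0)
    let ?E = "{y. (\<Sum>i\<le>m. e i * (\<sigma> ^^ i) y) = 0}"
    have E: "card ?E \<le> q ^ m"
      by (rule Suc.IH) (use em x0 Suc.prems in \<open>simp add: A_def\<close>)
    have split: "(\<Sum>i\<le>Suc m. c i * (\<sigma> ^^ i) (x0 * t)) = (\<Sum>i\<le>m. e i * (\<sigma> ^^ i) (\<sigma> t - t))" for t
    proof -
      have "(\<Sum>i\<le>m. e i * (\<sigma> ^^ i) (\<sigma> t - t)) =
          (\<Sum>i\<le>m. - (\<Sum>j\<le>i. A j) * ((\<sigma> ^^ Suc i) t - (\<sigma> ^^ i) t))"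
        by (simp add: e_def sp_diff funpow_swap1)
      also have "\<dots> = (\<Sum>i\<le>m. A i * (\<sigma> ^^ i) t) - (\<Sum>i\<le>m. A i) * (\<sigma> ^^ Suc m) t"
        by (rule sum_by_parts)
      also have "\<dots> = (\<Sum>i\<le>Suc m. A i * (\<sigma> ^^ i) t)"
        using em[symmetric] by (simp add: e_def)
      finally show ?thesis by (simp add: A_def sp_mult mult_ac)
    qed
    have "card ?Z \<le> card ?E * q"
    proof (rule card_le_fibres[where f = "\<lambda>x. \<sigma> (x / x0) - x / x0"])
      show "(\<lambda>x. \<sigma> (x / x0) - x / x0) ` ?Z \<subseteq> ?E"
        using split[of "x / x0" for x] x0(2) by (auto simp del: sum.atMost_Suc)
      fix y
      have "card {x \<in> ?Z. \<sigma> (x / x0) - x / x0 = y} \<le> card ((\<lambda>t. x0 * t) ` {t. \<sigma> t - t = y})"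
        by (rule card_mono) (use x0(2) in \<open>auto intro!: image_eqI[of _ _ "x / x0" for x]\<close>)
      also have "\<dots> \<le> q"
        by (rule order_trans[OF card_image_le card_additive_fibre]) simp
      finally show "card {x \<in> ?Z. \<sigma> (x / x0) - x / x0 = y} \<le> q" .
    qed simp_all
    also have "\<dots> \<le> q ^ Suc m" using E by (simp add: mult.commute)
    finally show ?thesis .
  qed
qed

section \<open>Partial norms, Hilbert 90 and surjectivity of the norm\<close>

definition partial_norm :: "'a \<Rightarrow> nat \<Rightarrow> 'a" where
  "partial_norm x k = (\<Prod>i<k. (\<sigma> ^^ i) x)"

lemma partial_norm_0 [simp]: "partial_norm x 0 = 1"
  and partial_norm_Suc: "partial_norm x (Suc k) = partial_norm x k * (\<sigma> ^^ k) x"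
  by (simp_all add: partial_norm_def)

lemma partial_norm_Suc': "partial_norm x (Suc k) = x * \<sigma> (partial_norm x k)"
proof (induction k)
  case (Suc k)
  have "\<sigma> (partial_norm x (Suc k)) = \<sigma> (partial_norm x k) * (\<sigma> ^^ Suc k) x"
    by (simp add: partial_norm_Suc mult)
  then show ?case
    using Suc by (metis mult.assoc partial_norm_Suc)
qed (simp add: partial_norm_def one)

lemma partial_norm_eq_0_iff [simp]: "partial_norm x k = 0 \<longleftrightarrow> x = 0 \<and> k > 0"
  by (induction k) (auto simp: partial_norm_Suc)

lemma partial_norm_mult: "partial_norm (x * y) k = partial_norm x k * partial_norm y k"
  by (simp add: partial_norm_def sp_mult prod.distrib)

lemma partial_norm_divide: "partial_norm (x / y) k = partial_norm x k / partial_norm y k"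
  by (simp add: partial_norm_def sp_divide prod_dividef)

text \<open>The product telescopes. For \<open>k = n\<close> the value is 1, the easy half of
  Hilbert 90.\<close>

lemma partial_norm_quotient:
  "x \<noteq> 0 \<Longrightarrow> partial_norm (\<sigma> x / x) k = (\<sigma> ^^ k) x / x"
  by (induction k) (simp_all add: partial_norm_Suc sp_divide funpow_swap1)

text \<open>The partial norm of length n + 1 is \<open>x * \<sigma> N\<close> when the first factor
  is split off and \<open>N * x\<close> when the last one is, so the norm \<open>N\<close> is fixed
  by \<open>\<sigma>\<close>.\<close>

lemma norm_in_K: "partial_norm x n \<in> K"
proof (cases "x = 0")
  case False
  have "x * \<sigma> (partial_norm x n) = partial_norm x n * x"
    using partial_norm_Suc'[of x n] partial_norm_Suc[of x n] funpow_n[of x] by metis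
  then have "\<sigma> (partial_norm x n) = partial_norm x n"
    using False by (metis mult.commute mult_left_cancel)
  then show ?thesis by (simp add: fixed)
qed (cases n; simp add: partial_norm_Suc zero_in_K one_in_K)

lemma n_pos: "n > 0"
proof (rule ccontr)
  assume "\<not> n > 0"
  then have "card (UNIV :: 'a set) = 1" using card_UNIV by simp
  then show False
    by (metis card_1_singletonE UNIV_I singletonD zero_neq_one)
qed

text \<open>The inverse of a nonzero Lagrange resolvent is the required element. A nonzero value
  exists because the resolvent has \<sigma>-degree n - 1, hence at most q^(n-1) zeros; this count
  takes the place of independence of characters.\<close>

theorem hilbert_90:
  assumes "partial_norm \<rho> n = 1"
  obtains x where "x \<noteq> 0" "\<sigma> x / x = \<rho>"
proof -
  have \<rho>: "\<rho> \<noteq> 0" using assms n_pos by (metis partial_norm_eq_0_iff zero_neq_one)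
  obtain m where m: "n = Suc m" using n_pos gr0_implies_Suc by auto
  let ?T = "\<lambda>\<theta>. \<Sum>i\<le>m. partial_norm \<rho> i * (\<sigma> ^^ i) \<theta>"
  have "card {\<theta>. ?T \<theta> = 0} \<le> q ^ m"
    by (rule card_kernel_le) (simp add: \<rho>)
  also have "\<dots> < q ^ n" using q_ge_2 by (simp add: m)
  finally have "{\<theta>. ?T \<theta> = 0} \<noteq> UNIV" using card_UNIV by auto
  then obtain \<theta> where \<theta>: "?T \<theta> \<noteq> 0" by auto
  \<comment> \<open>This shifts the resolvent by one index. The term lost at index 0 is \<theta>,
    and the term gained at index n is again \<theta>, since \<rho> has norm 1.\<close>
  have "\<rho> * \<sigma> (?T \<theta>) = (\<Sum>i\<le>m. partial_norm \<rho> (Suc i) * (\<sigma> ^^ Suc i) \<theta>)"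
    by (simp add: s_simps sum_distrib_left partial_norm_Suc' mult_ac)
  also have "\<dots> = (\<Sum>i\<le>Suc m. partial_norm \<rho> i * (\<sigma> ^^ i) \<theta>) - \<theta>"
    by (subst sum.atMost_Suc_shift) simp
  also have "\<dots> = ?T \<theta>"
    using assms funpow_n[of \<theta>] by (simp add: m)
  finally have "\<rho> * \<sigma> (?T \<theta>) = ?T \<theta>" .
  moreover have "\<sigma> (inverse t) / inverse t = \<rho>" if "\<rho> * \<sigma> t = t" "t \<noteq> 0" for t
  proof -
    have "\<rho> = t / \<sigma> t" using that by (simp add: nonzero_eq_divide_eq)
    then show ?thesis by (simp add: s_simps divide_inverse)
  qed
  ultimately have "\<sigma> (inverse (?T \<theta>)) / inverse (?T \<theta>) = \<rho>"
    using \<theta> by blast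
  then show ?thesis using \<theta> that[of "inverse (?T \<theta>)"] by simp
qed

text \<open>Two nonzero elements have the same quotient \<open>\<sigma> x / x\<close> exactly when
  their ratio lies in \<open>K\<close>, so each fibre is an orbit under
  \<open>K - {0}\<close>.\<close>

lemma card_quotient_image:
  assumes "0 \<notin> A" "\<And>x k. x \<in> A \<Longrightarrow> k \<in> K \<Longrightarrow> k \<noteq> 0 \<Longrightarrow> k * x \<in> A" "\<rho> \<noteq> 0"
  shows "card A = card ((\<lambda>x. \<rho> * (\<sigma> x / x)) ` A) * (q - 1)"
proof (rule card_eq_fibres)
  fix y assume "y \<in> (\<lambda>x. \<rho> * (\<sigma> x / x)) ` A"
  then obtain x where x: "x \<in> A" "y = \<rho> * (\<sigma> x / x)" by auto
  then have x0: "x \<noteq> 0" using assms(1) by auto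
  have "{x' \<in> A. \<rho> * (\<sigma> x' / x') = y} = (\<lambda>k. k * x) ` (K - {0})"
  proof (intro equalityI subsetI)
    fix x' assume *: "x' \<in> {x' \<in> A. \<rho> * (\<sigma> x' / x') = y}"
    then have "x' \<noteq> 0" using assms(1) by auto
    with * x x0 assms(3) have "\<sigma> (x' / x) = x' / x"
      by (simp add: s_simps field_simps)
    then have "x' / x \<in> K - {0}" using fixed x0 \<open>x' \<noteq> 0\<close> by simp
    then show "x' \<in> (\<lambda>k. k * x) ` (K - {0})"
      by (intro image_eqI[of _ _ "x' / x"]) (use x0 in auto)
  next
    fix x' assume "x' \<in> (\<lambda>k. k * x) ` (K - {0})"
    then obtain k where "k \<in> K" "k \<noteq> 0" "x' = k * x" by auto
    then show "x' \<in> {x' \<in> A. \<rho> * (\<sigma> x' / x') = y}"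
      using x assms(2) by (simp add: s_simps fixed[THEN iffD2])
  qed
  moreover have "card ((\<lambda>k. k * x) ` (K - {0})) = q - 1"
    by (subst card_image) (use x0 in \<open>auto simp: inj_on_def card_K zero_in_K card_Diff_singleton\<close>)
  ultimately show "card {x' \<in> A. \<rho> * (\<sigma> x' / x') = y} = q - 1" by simp
qed simp

text \<open>The nonzero elements are counted twice: through \<open>\<sigma> x / x\<close>, with
  fibres of size q - 1, and through the norm, whose fibres are by Hilbert 90 cosets of the image of
  the first map. So the norm takes q - 1 values, which fill \<open>K - {0}\<close>.\<close>

lemma norm_surj:
  assumes "k \<in> K" "k \<noteq> 0"
  obtains \<rho> where "\<rho> \<noteq> 0" "partial_norm \<rho> n = k"
proof -
  let ?U = "UNIV - {0 :: 'a}" and ?N = "\<lambda>x. partial_norm x n"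
  let ?k = "card ((\<lambda>x. 1 * (\<sigma> x / x)) ` ?U)"
  have U: "card ?U = ?k * (q - 1)"
    by (rule card_quotient_image) auto
  have N: "card ?U = card (?N ` ?U) * ?k"
  proof (rule card_eq_fibres)
    fix y assume "y \<in> ?N ` ?U"
    then obtain x where x: "x \<noteq> 0" "y = ?N x" by auto
    have "{x' \<in> ?U. ?N x' = y} = (\<lambda>u. x * u) ` (\<lambda>x. 1 * (\<sigma> x / x)) ` ?U"
    proof (intro equalityI subsetI)
      fix x' assume "x' \<in> {x' \<in> ?U. ?N x' = y}"
      then have "?N (x' / x) = 1" using x by (simp add: partial_norm_divide)
      then obtain t where "t \<noteq> 0" "\<sigma> t / t = x' / x" using hilbert_90 by blast
      then show "x' \<in> (\<lambda>u. x * u) ` (\<lambda>x. 1 * (\<sigma> x / x)) ` ?U"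
        by (auto simp: image_image intro!: image_eqI[of _ _ t]) (use x in \<open>simp add: field_simps\<close>)
    qed (use x in \<open>auto simp: partial_norm_mult partial_norm_quotient funpow_n
          simp del: times_divide_eq_right\<close>)
    then show "card {x' \<in> ?U. ?N x' = y} = ?k"
      by (simp add: card_image inj_on_def x)
  qed simp
  have "1 \<in> ?U" by simp
  then have U0: "card ?U > 0" by (metis card_gt_0_iff empty_iff finite)
  have "c = b" if "a = k * b" "a = c * k" "a > 0" for a b c k :: nat
    using that by auto
  from this[OF U N U0] have "card (?N ` ?U) = q - 1" .
  moreover have "?N ` ?U \<subseteq> K - {0}" using norm_in_K by auto
  moreover have "card (K - {0}) = q - 1" by (simp add: card_K zero_in_K)
  ultimately have "?N ` ?U = K - {0}" by (intro card_subset_eq) auto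
  then have "k \<in> ?N ` ?U" using assms by simp
  then show ?thesis using that by auto
qed

end

section \<open>Galois generators\<close>

lemma subfield_type_algebraD:
  assumes "subfield K (ring_of_type_algebra :: 'a::field ring)"
  shows "0 \<in> K" "1 \<in> K" "x \<in> K \<Longrightarrow> y \<in> K \<Longrightarrow> x * y \<in> K"
proof -
  note sub = subringE[OF subfieldE(1)[OF assms]]
  show "0 \<in> K" "1 \<in> K" "x \<in> K \<Longrightarrow> y \<in> K \<Longrightarrow> x * y \<in> K"
    using sub(2,3) sub(6)[of x y] by (simp_all add: ring_of_type_algebra_def)
qed

text \<open>Multiplication by a nonzero \<open>x\<close> permutes \<open>K - {0}\<close>; the
  products over that set are compared.\<close>

lemma power_card_eq_self:
  fixes K :: "'a::field set"
  assumes "finite K" "0 \<in> K" "\<And>x y. x \<in> K \<Longrightarrow> y \<in> K \<Longrightarrow> x * y \<in> K" "x \<in> K"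
  shows "x ^ card K = x"
proof (cases "x = 0")
  case True
  then show ?thesis using assms(1,2) by (auto simp: card_gt_0_iff power_0_left)
next
  case False
  have inj: "inj_on ((*) x) (K - {0})" using False by (auto simp: inj_on_def)
  have "(*) x ` (K - {0}) = K - {0}"
    by (rule card_subset_eq) (use assms False in \<open>auto simp: card_image[OF inj]\<close>)
  then have "(\<Prod>y\<in>K - {0}. y) = (\<Prod>y\<in>K - {0}. x * y)"
    using prod.reindex[OF inj, of "\<lambda>y. y"] by simp
  also have "\<dots> = x ^ card (K - {0}) * (\<Prod>y\<in>K - {0}. y)"
    by (simp add: prod.distrib)
  finally have "x ^ card (K - {0}) = 1"
    using assms(1) by simp
  then have "x ^ Suc (card (K - {0})) = x" by simp
  also have "Suc (card (K - {0})) = card K"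
    using assms(1,2) by (rule card_Suc_Diff1)
  finally show ?thesis .
qed

lemma prime_power_sum_power:
  fixes x y :: "'a::{field,finite}"
  assumes "primepow q" "card (UNIV :: 'a set) = q ^ n"
  shows "(x + y) ^ q = x ^ q + y ^ q"
proof -
  obtain p k where p: "Factorial_Ring.prime p" "q = p ^ k" using assms(1) by (auto simp: primepow_def)
  have char: "Factorial_Ring.prime CHAR('a)"
    by (intro prime_CHAR_semidom finite_imp_CHAR_pos) simp
  have "CHAR('a) dvd p ^ (k * n)"
    using CHAR_dvd_CARD[where 'a = 'a] assms(2) p(2) by (simp add: power_mult)
  then have "CHAR('a) = p"
    using char p(1) prime_dvd_power primes_dvd_imp_eq by blast
  then show ?thesis using freshmans_dream'[OF char, of q k x y] p(2) by simp
qed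

lemma map_poly_mult_hom:
  fixes h :: "'a::comm_semiring_0 \<Rightarrow> 'b::comm_semiring_0"
  assumes "h 0 = 0" "\<And>x y. h (x + y) = h x + h y" "\<And>x y. h (x * y) = h x * h y"
  shows "map_poly h (p * r) = map_poly h p * map_poly h r"
proof -
  have "h (\<Sum>i\<in>I. f i) = (\<Sum>i\<in>I. h (f i))" for I :: "nat set" and f
    by (induction I rule: infinite_finite_induct) (simp_all add: assms)
  then show ?thesis
    by (intro poly_eqI) (simp add: coeff_map_poly coeff_mult assms)
qed

lemma map_poly_linear_prod_hom:
  fixes h :: "'a::field \<Rightarrow> 'a"
  assumes "\<And>x y. h (x + y) = h x + h y" "\<And>x y. h (x * y) = h x * h y" "h 1 = 1"
  shows "map_poly h (\<Prod>i\<in>I. [:- f i, 1:]) = (\<Prod>i\<in>I. [:- h (f i), 1:])"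
proof -
  have h0: "h 0 = 0" using assms(1)[of 0 0] by (metis add_0 add_cancel_right_left)
  have "h (- x) = - h x" for x
    using assms(1)[of x "- x"] h0 by (simp add: eq_neg_iff_add_eq_0 add.commute)
  then show ?thesis
    by (induction I rule: infinite_finite_induct)
      (simp_all add: map_poly_mult_hom[OF h0 assms(1,2)] map_poly_pCons h0 assms(3) map_poly_1
        del: mult_pCons_left)
qed

lemma poly_map_poly_hom:
  fixes h :: "'a::field \<Rightarrow> 'a"
  assumes "\<And>x y. h (x + y) = h x + h y" "\<And>x y. h (x * y) = h x * h y"
  shows "poly (map_poly h p) (h x) = h (poly p x)"
proof -
  have h0: "h 0 = 0" using assms(1)[of 0 0] by (metis add_0 add_cancel_right_left)
  show ?thesis
    by (induction p) (simp_all add: map_poly_pCons h0 assms)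
qed

text \<open>A conjugate of \<open>x\<close> is a root of the product of the \<open>X - x ^ q ^ i\<close>, whose coefficients are
  fixed by the Frobenius map.\<close>

lemma automorphism_is_pointwise_frobenius:
  fixes \<sigma> :: "'a::{field,finite} \<Rightarrow> 'a"
  assumes q: "primepow q" "card (UNIV :: 'a set) = q ^ n"
    and hom: "\<And>x y. \<sigma> (x + y) = \<sigma> x + \<sigma> y" "\<And>x y. \<sigma> (x * y) = \<sigma> x * \<sigma> y" "\<sigma> 1 = 1"
    and frob: "\<And>x. x ^ q = x \<Longrightarrow> \<sigma> x = x"
  obtains i where "\<sigma> x = x ^ (q ^ i)"
proof -
  define f where "f = (\<Prod>i<n. [:- (x ^ (q ^ i)), 1:])"
  have top: "x ^ (q ^ n) = x"
    using power_card_eq_self[of "UNIV :: 'a set" x] q(2) by simp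
  have "map_poly (\<lambda>y. y ^ q) f = (\<Prod>i<n. [:- ((x ^ (q ^ i)) ^ q), 1:])"
    unfolding f_def
    by (rule map_poly_linear_prod_hom)
      (simp_all add: prime_power_sum_power[OF q] power_mult_distrib)
  also have "\<dots> = (\<Prod>i<n. [:- (x ^ (q ^ Suc i)), 1:])"
    by (simp add: mult.commute flip: power_mult)
  also have "\<dots> = f"
  proof -
    \<comment> \<open>Frobenius moves each linear factor to the next one, and x^(q^n) = x closes the
      cycle.\<close>
    define g where "g i = [:- (x ^ (q ^ i)), 1:]" for i
    have "g 0 * (\<Prod>i<n. g (Suc i)) = (\<Prod>i<n. g i) * g n"
      using prod.lessThan_Suc[of g n] by (simp only: prod.lessThan_Suc_shift)
    moreover have "g n = g 0" "g 0 \<noteq> 0" by (simp_all add: g_def top)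
    ultimately have "(\<Prod>i<n. g (Suc i)) = (\<Prod>i<n. g i)"
      by (metis mult.commute mult_left_cancel)
    then show ?thesis by (simp only: g_def f_def)
  qed
  finally have "Polynomial.coeff (map_poly (\<lambda>y. y ^ q) f) k = Polynomial.coeff f k" for k by simp
  moreover have "q > 0" using primepow_gt_0_nat[OF q(1)] .
  ultimately have "Polynomial.coeff f k ^ q = Polynomial.coeff f k" for k
    by (simp add: coeff_map_poly power_0_left)
  then have "map_poly \<sigma> f = f"
    using frob frob[of 0] \<open>q > 0\<close> by (intro poly_eqI) (simp add: coeff_map_poly power_0_left)
  moreover have "\<sigma> 0 = 0" using frob[of 0] \<open>q > 0\<close> by (simp add: power_0_left)
  moreover have "n > 0"
  proof (rule ccontr)
    assume "\<not> n > 0"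
    then have "card (UNIV :: 'a set) = 1" using q(2) by simp
    then show False by (metis card_1_singletonE UNIV_I singletonD zero_neq_one)
  qed
  then have "poly f x = 0" by (auto simp: f_def poly_prod intro!: bexI[of _ 0])
  ultimately have "poly f (\<sigma> x) = 0"
    using poly_map_poly_hom[of \<sigma> f x] hom by simp
  then show ?thesis using that by (auto simp: f_def poly_prod)
qed

text \<open>Frobenius lies in the group generated by \<open>\<sigma>\<close>, so everything fixed by
  \<open>\<sigma>\<close> satisfies x^q = x and thus lies in \<open>K\<close>. The order of
  \<open>\<sigma>\<close> divides n because \<open>\<sigma>\<close> acts on each element as a power
  of Frobenius.\<close>

lemma cyclic_extension_of_galois_generator:
  fixes K :: "'a::{field,finite} set"
  assumes q: "primepow q" and card: "card (UNIV :: 'a set) = q ^ n"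
    and K: "subfield K ring_of_type_algebra" and cK: "card K = q"
    and gen: "galois_generator K \<sigma>"
  shows "cyclic_extension \<sigma> K q n"
proof -
  let ?G = "galois_group K"
  have q0: "q > 0" using primepow_gt_0_nat[OF q] .
  have G: "\<tau> \<in> carrier ?G \<longleftrightarrow> (\<forall>x y. \<tau> (x + y) = \<tau> x + \<tau> y) \<and> (\<forall>x y. \<tau> (x * y) = \<tau> x * \<tau> y) \<and>
      \<tau> 1 = 1 \<and> bij \<tau> \<and> (\<forall>x\<in>K. \<tau> x = x)" for \<tau>
    by (auto simp: galois_group_def ring_iso_def ring_hom_def ring_of_type_algebra_def)
  have \<sigma>: "\<sigma> \<in> carrier ?G" and genG: "generate ?G {\<sigma>} = carrier ?G"
    using gen by (simp_all add: galois_generator_def)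
  have K_pow: "x ^ q = x" if "x \<in> K" for x
    using power_card_eq_self[of K x] subfield_type_algebraD[OF K] that by (simp add: cK)
  have "card {x :: 'a. x ^ q = x} \<le> q"
  proof -
    let ?p = "Polynomial.monom 1 q - [:0, 1:] :: 'a poly"
    have q1: "q > 1" using primepow_gt_Suc_0[OF q] by simp
    have "Polynomial.coeff ?p q = 1" using q1 by (simp add: coeff_pCons split: nat.split)
    then have "?p \<noteq> 0" by (metis coeff_0 zero_neq_one)
    moreover have "Polynomial.degree ?p \<le> q"
      using q1 by (intro degree_diff_le) (simp_all add: degree_monom_le)
    moreover have "{x. poly ?p x = 0} = {x. x ^ q = x}" by (simp add: poly_monom)
    ultimately show ?thesis using card_poly_roots_bound[of ?p] by simp
  qed
  then have frob_fixed: "{x. x ^ q = x} = K"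
    using K_pow by (metis (mono_tags, lifting) card_seteq cK finite mem_Collect_eq subsetI)
  \<comment> \<open>The inverse in a monoid record is a definite description, so an inverse must be
    exhibited and shown to be unique before anything is known about it.\<close>
  have inv: "inv\<^bsub>?G\<^esub> \<sigma> \<in> carrier ?G \<and> \<sigma> \<circ> inv\<^bsub>?G\<^esub> \<sigma> = id \<and> inv\<^bsub>?G\<^esub> \<sigma> \<circ> \<sigma> = id"
  proof -
    let ?\<tau> = "inv_into UNIV \<sigma>"
    have bij: "bij \<sigma>" using \<sigma> G by blast
    have "\<sigma> (?\<tau> x) = x" "?\<tau> (\<sigma> x) = x" for x
      using bij by (simp_all add: bij_is_surj surj_f_inv_f bij_is_inj)
    then have "?\<tau> \<in> carrier ?G"
      using \<sigma> unfolding G by (metis bij bij_imp_bij_inv)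
    then have ex: "\<exists>\<tau>. \<tau> \<in> carrier ?G \<and> \<sigma> \<otimes>\<^bsub>?G\<^esub> \<tau> = \<one>\<^bsub>?G\<^esub> \<and> \<tau> \<otimes>\<^bsub>?G\<^esub> \<sigma> = \<one>\<^bsub>?G\<^esub>"
      using bij by (intro exI[of _ ?\<tau>])
        (auto simp: galois_group_def fun_eq_iff bij_is_surj surj_f_inv_f bij_is_inj)
    have uniq: "\<exists>!\<tau>. \<tau> \<in> carrier ?G \<and> \<sigma> \<otimes>\<^bsub>?G\<^esub> \<tau> = \<one>\<^bsub>?G\<^esub> \<and> \<tau> \<otimes>\<^bsub>?G\<^esub> \<sigma> = \<one>\<^bsub>?G\<^esub>"
      using ex by (auto simp: galois_group_def) (metis comp_assoc comp_id id_comp)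
    show ?thesis
      using theI'[OF uniq] by (simp add: m_inv_def galois_group_def)
  qed
  have fix_gen: "\<tau> x = x" if "\<tau> \<in> generate ?G {\<sigma>}" "\<sigma> x = x" for \<tau> x
    using that(1)
  proof induction
    case (inv h)
    then show ?case using inv that(2) \<open>inv\<^bsub>?G\<^esub> \<sigma> \<in> _ \<and> _\<close> by (metis comp_apply id_apply singletonD)
  qed (use that(2) in \<open>simp_all add: galois_group_def\<close>)
  have "bij (\<lambda>x :: 'a. x ^ q)"
  proof -
    have "inj (\<lambda>x :: 'a. x ^ q)"
    proof (rule injI)
      fix x y :: 'a assume "x ^ q = y ^ q"
      have "(x - y) ^ q + y ^ q = x ^ q"
        using prime_power_sum_power[OF q card, of "x - y" y] by simp
      then show "x = y" using \<open>x ^ q = y ^ q\<close> by simp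
    qed
    then show ?thesis by (simp add: bij_def finite_UNIV_inj_surj)
  qed
  then have frobG: "(\<lambda>x. x ^ q) \<in> carrier ?G"
    unfolding G using K_pow by (simp add: prime_power_sum_power[OF q card] power_mult_distrib)
  have fixed: "\<sigma> x = x \<longleftrightarrow> x \<in> K" for x
  proof
    assume "\<sigma> x = x"
    then have "x ^ q = x" using fix_gen[of "\<lambda>x. x ^ q" x] frobG genG by simp
    then show "x \<in> K" using frob_fixed by blast
  next
    assume "x \<in> K"
    then show "\<sigma> x = x" using \<sigma> unfolding G by blast
  qed
  have hom: "\<sigma> (x + y) = \<sigma> x + \<sigma> y" "\<sigma> (x * y) = \<sigma> x * \<sigma> y" "\<sigma> 1 = 1" for x y
    using \<sigma> unfolding G by blast+
  have pow: "\<sigma> (x ^ k) = \<sigma> x ^ k" for x k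
    by (induction k) (simp_all add: hom)
  have "(\<sigma> ^^ n) x = x" for x
  proof -
    \<comment> \<open>The exponent \<open>i\<close> may vary with \<open>x\<close>, but powers of
      \<open>x\<close> inherit it, so it stays constant along the orbit of \<open>x\<close>.\<close>
    obtain i where i: "\<sigma> x = x ^ (q ^ i)"
      using automorphism_is_pointwise_frobenius[OF q card hom, of x] fixed frob_fixed by blast
    have "(\<sigma> ^^ k) x = x ^ (q ^ (i * k))" for k
      by (induction k) (simp_all add: pow i power_add mult.commute flip: power_mult)
    then have "(\<sigma> ^^ n) x = x ^ (q ^ n) ^ i" by (simp add: power_mult mult.commute flip: power_mult)
    also have "x ^ (q ^ n) ^ j = x" for j
      using power_card_eq_self[of "UNIV :: 'a set" x] card by (induction j) (simp_all add: power_mult)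
    finally show ?thesis .
  qed
  then show ?thesis
    using hom fixed cK card by unfold_locales
qed

section \<open>The recurrence attached to the polynomial\<close>

lemma induct3 [case_names 0 1 2 step]:
  fixes P :: "nat \<Rightarrow> bool"
  assumes "P 0" "P (Suc 0)" "P (Suc (Suc 0))"
    and "\<And>k. P k \<Longrightarrow> P (Suc k) \<Longrightarrow> P (Suc (Suc k)) \<Longrightarrow> P (Suc (Suc (Suc k)))"
  shows "P k"
proof -
  have "P k \<and> P (Suc k) \<and> P (Suc (Suc k))"
    by (induction k) (use assms in auto)
  then show ?thesis by simp
qed

context cyclic_extension
begin

text \<open>Vanishing top coefficients are dropped until a nonzero one leads, which only improves
  the bound.\<close>

lemma card_kernel_le_nontrivial:
  assumes "i \<le> m" "c i \<noteq> 0"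
  shows "card {x. (\<Sum>i\<le>m. c i * (\<sigma> ^^ i) x) = 0} \<le> q ^ m"
  using assms
proof (induction m)
  case 0
  then show ?case using card_kernel_le[of c 0] by simp
next
  case (Suc m)
  show ?case
  proof (cases "c (Suc m) = 0")
    case True
    then have "i \<le> m" using Suc.prems by (metis le_SucE)
    then have "card {x. (\<Sum>i\<le>m. c i * (\<sigma> ^^ i) x) = 0} \<le> q ^ m"
      using Suc by simp
    also have "\<dots> \<le> q ^ Suc m" using q_ge_2 by simp
    finally show ?thesis using True by simp
  qed (rule card_kernel_le)
qed

end

locale cubic_sigma_polynomial = cyclic_extension +
  fixes a b c d :: 'a
  assumes coeffs_nonzero [simp]: "a \<noteq> 0" "b \<noteq> 0" "c \<noteq> 0" "d \<noteq> 0"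
begin

text \<open>The defect of \<open>u\<close> in the recurrence at index \<open>k\<close>. Keeping it
  as a function also covers the inhomogeneous case, needed for variation of constants.\<close>

definition residual :: "(nat \<Rightarrow> 'a) \<Rightarrow> nat \<Rightarrow> 'a" where
  "residual u k = (\<sigma> ^^ k) a * u k + (\<sigma> ^^ k) b * u (Suc k) + (\<sigma> ^^ k) c * u (Suc (Suc k)) +
    (\<sigma> ^^ k) d * u (Suc (Suc (Suc k)))"

fun sol :: "'a \<Rightarrow> 'a \<Rightarrow> 'a \<Rightarrow> nat \<Rightarrow> 'a" where
  "sol u0 u1 u2 0 = u0"
| "sol u0 u1 u2 (Suc 0) = u1"
| "sol u0 u1 u2 (Suc (Suc 0)) = u2"
| "sol u0 u1 u2 (Suc (Suc (Suc k))) = - ((\<sigma> ^^ k) a * sol u0 u1 u2 k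
     + (\<sigma> ^^ k) b * sol u0 u1 u2 (Suc k) + (\<sigma> ^^ k) c * sol u0 u1 u2 (Suc (Suc k))) / (\<sigma> ^^ k) d"

abbreviation "\<alpha> \<equiv> sol 1 0 0"
abbreviation "\<beta> \<equiv> sol 0 1 0"
abbreviation "\<gamma> \<equiv> sol 0 0 1"

lemma sp_d_mult_cancel: "(\<sigma> ^^ k) d * x = (\<sigma> ^^ k) d * y \<longleftrightarrow> x = y"
  by simp

lemma residual_sol: "residual (sol u0 u1 u2) k = 0"
  by (simp add: residual_def)

lemma residual_0_imp_eq:
  assumes "\<And>k. residual u k = 0"
  shows "u k = u 0 * \<alpha> k + u (Suc 0) * \<beta> k + u (Suc (Suc 0)) * \<gamma> k"
proof (induction k rule: induct3)
  case (step k)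
  let ?v = "\<lambda>k. u 0 * \<alpha> k + u (Suc 0) * \<beta> k + u (Suc (Suc 0)) * \<gamma> k"
  have "residual ?v k = u 0 * residual \<alpha> k + u (Suc 0) * residual \<beta> k + u (Suc (Suc 0)) * residual \<gamma> k"
    unfolding residual_def by (simp only: algebra_simps)
  then have "residual ?v k = residual u k"
    by (simp add: assms residual_sol del: sol.simps)
  then have "(\<sigma> ^^ k) d * u (Suc (Suc (Suc k))) = (\<sigma> ^^ k) d * ?v (Suc (Suc (Suc k)))"
    unfolding residual_def step[symmetric] by simp
  then show ?case
    by (rule iffD1[OF sp_d_mult_cancel])
qed simp_all

text \<open>Applying \<sigma> to a solution turns the coefficients of index k into those of index k
  + 1. Both sides therefore obey the same recurrence, and agreement at three consecutive places
  propagates.\<close>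

lemma shift_step:
  assumes "\<And>i. i < 3 \<Longrightarrow> u (Suc (k + i)) = \<sigma> (v (k + i)) + e * \<sigma> (w (k + i))"
    and "residual u (Suc k) = 0" "residual v k = 0" "residual w k = 0"
  shows "u (Suc (k + 3)) = \<sigma> (v (k + 3)) + e * \<sigma> (w (k + 3))"
proof -
  let ?r = "\<lambda>i. \<sigma> (v (k + i)) + e * \<sigma> (w (k + i))"
  have "0 = \<sigma> (residual v k) + e * \<sigma> (residual w k)"
    by (simp add: assms(3,4))
  also have "\<dots> = (\<sigma> ^^ Suc k) a * ?r 0 + (\<sigma> ^^ Suc k) b * ?r 1 + (\<sigma> ^^ Suc k) c * ?r 2 + (\<sigma> ^^ Suc k) d * ?r 3"
    by (simp add: residual_def s_simps algebra_simps numeral_2_eq_2 numeral_3_eq_3)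
  finally have "(\<sigma> ^^ Suc k) d * ?r 3 =
      - ((\<sigma> ^^ Suc k) a * ?r 0 + (\<sigma> ^^ Suc k) b * ?r 1 + (\<sigma> ^^ Suc k) c * ?r 2)"
    by (rule add_eq_0_iff[THEN iffD1, OF sym])
  also have "\<dots> = - ((\<sigma> ^^ Suc k) a * u (Suc k) + (\<sigma> ^^ Suc k) b * u (Suc (Suc k))
      + (\<sigma> ^^ Suc k) c * u (Suc (Suc (Suc k))))"
    using assms(1)[of 0] assms(1)[of 1] assms(1)[of 2] by (simp add: numeral_2_eq_2)
  also have "\<dots> = (\<sigma> ^^ Suc k) d * u (Suc (k + 3))"
    using assms(2) unfolding residual_def add_eq_0_iff
    by (simp only: numeral_3_eq_3 add_Suc_right add_0_right)
  finally have "(\<sigma> ^^ Suc k) d * u (Suc (k + 3)) = (\<sigma> ^^ Suc k) d * ?r 3" ..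
  then show ?thesis by (rule iffD1[OF sp_d_mult_cancel])
qed

text \<open>Both sides solve the recurrence from index 1 on, so three initial values decide; the
  factor \<open>- c / d\<close> is \<gamma> at 3. In the same way \<open>- b / d\<close> below is
  \<beta> at 3.\<close>

lemma gamma_shift: "\<gamma> (Suc k) = \<sigma> (\<beta> k) + (- c / d) * \<sigma> (\<gamma> k)"
proof (induction k rule: induct3)
  case (step k)
  have "\<gamma> (Suc (k + i)) = \<sigma> (\<beta> (k + i)) + (- c / d) * \<sigma> (\<gamma> (k + i))" if "i < 3" for i
    using that step by (auto simp: less_Suc_eq numeral_3_eq_3)
  from shift_step[of \<gamma> k \<beta> "- c / d" \<gamma>, OF this residual_sol residual_sol residual_sol]
  show ?case by (simp only: numeral_3_eq_3 add_Suc_right add_0_right)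
qed (simp_all add: one)

lemma beta_shift: "\<beta> (Suc k) = \<sigma> (\<alpha> k) + (- b / d) * \<sigma> (\<gamma> k)"
proof (induction k rule: induct3)
  case (step k)
  have "\<beta> (Suc (k + i)) = \<sigma> (\<alpha> (k + i)) + (- b / d) * \<sigma> (\<gamma> (k + i))" if "i < 3" for i
    using that step by (auto simp: less_Suc_eq numeral_3_eq_3)
  from shift_step[of \<beta> k \<alpha> "- b / d" \<gamma>, OF this residual_sol residual_sol residual_sol]
  show ?case by (simp only: numeral_3_eq_3 add_Suc_right add_0_right)
qed (simp_all add: one)

text \<open>As \<open>a\<close> is nonzero the recurrence runs backwards, and three consecutive
  zeros would propagate down to \<gamma> at 2, which is 1.\<close>

lemma gamma_no_three_zeros: "\<not> (\<gamma> k = 0 \<and> \<gamma> (Suc k) = 0 \<and> \<gamma> (Suc (Suc k)) = 0)"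
proof (induction k)
  case (Suc k)
  show ?case
  proof
    assume *: "\<gamma> (Suc k) = 0 \<and> \<gamma> (Suc (Suc k)) = 0 \<and> \<gamma> (Suc (Suc (Suc k))) = 0"
    then have "(\<sigma> ^^ k) a * \<gamma> k = 0"
      using residual_sol[of 0 0 1 k] by (simp add: residual_def del: sol.simps)
    then show False using Suc * by simp
  qed
qed simp

text \<open>Dividing by the partial norm of \<open>c / d\<close> normalises the coefficient of the
  latest term to -1. What remains of the other two coefficients is exactly expressed by
  \<open>z\<close> and \<open>w\<close>.\<close>

lemma gamma_eq_H:
  assumes w: "w = w_param \<sigma> a b c" and z: "z = z_param \<sigma> b c d"
  shows "\<gamma> (Suc (Suc k)) = partial_norm (c / d) k * H \<sigma> w z k"
proof (induction k rule: induct3)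
  case 1
  then show ?case by (simp add: partial_norm_Suc)
next
  case 2
  then show ?case
    by (simp add: partial_norm_Suc z z_param_def s_simps divide_simps)
next
  case (step k)
  let ?s = "\<lambda>i. (\<sigma> ^^ (k + i))"
  have sp_s: "(\<sigma> ^^ k) (\<sigma> x) = ?s 1 x" "(\<sigma> ^^ (k + 1)) (\<sigma> x) = ?s 2 x" for x
    by (simp_all add: funpow_swap1)
  have z1: "(\<sigma> ^^ (k + 1)) z = ?s 2 b * ?s 1 d / (?s 2 c * ?s 1 c)"
    and z0: "(\<sigma> ^^ k) z = ?s 1 b * ?s 0 d / (?s 1 c * ?s 0 c)"
    and w1: "(\<sigma> ^^ (k + 1)) w = ?s 2 a * ?s 1 c / (?s 2 b * ?s 1 b)"
    by (simp_all only: z z_param_def w w_param_def sp_divide sp_mult sp_s add_0_right)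
  define p h0 h1 h2 where "p = partial_norm (c / d) k"
    and "h0 = H \<sigma> w z k" and "h1 = H \<sigma> w z (Suc k)" and "h2 = H \<sigma> w z (Suc (Suc k))"
  \<comment> \<open>Digit i marks the image under \<sigma>^(k+i). With opaque names the claim is a
    rational identity in independent letters.\<close>
  define a2 b1 b2 c0 c1 c2 d0 d1 d2 where "a2 = ?s 2 a" and "b1 = ?s 1 b" and "b2 = ?s 2 b"
    and "c0 = ?s 0 c" and "c1 = ?s 1 c" and "c2 = ?s 2 c"
    and "d0 = ?s 0 d" and "d1 = ?s 1 d" and "d2 = ?s 2 d"
  note defs = a2_def b1_def b2_def c0_def c1_def c2_def d0_def d1_def d2_def
  have nz: "b1 \<noteq> 0" "b2 \<noteq> 0" "c0 \<noteq> 0" "c1 \<noteq> 0" "c2 \<noteq> 0" "d0 \<noteq> 0" "d1 \<noteq> 0" "d2 \<noteq> 0"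
    unfolding defs by (simp_all only: sp_eq_0_iff coeffs_nonzero not_False_eq_True)
  have pn: "partial_norm (c / d) (Suc k) = p * (c0 / d0)"
    "partial_norm (c / d) (Suc (Suc k)) = p * (c0 / d0) * (c1 / d1)"
    "partial_norm (c / d) (Suc (Suc (Suc k))) = p * (c0 / d0) * (c1 / d1) * (c2 / d2)"
    by (simp_all add: partial_norm_Suc p_def defs sp_divide s_simps)
  have H3: "H \<sigma> w z (Suc (Suc (Suc k))) = - h2 - b2 * d1 / (c2 * c1) * h1
      - a2 * c1 / (b2 * b1) * (b2 * d1 / (c2 * c1) * (b1 * d0 / (c1 * c0))) * h0"
    unfolding H.simps(4) z1 z0 w1 by (simp only: h0_def h1_def h2_def defs)
  have "\<gamma> (Suc (Suc (Suc (Suc (Suc k))))) = - (a2 * \<gamma> (Suc (Suc k)) + b2 * \<gamma> (Suc (Suc (Suc k)))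
      + c2 * \<gamma> (Suc (Suc (Suc (Suc k))))) / d2"
    unfolding sol.simps(4)[of _ _ _ "Suc (Suc k)"] defs by (simp only: numeral_2_eq_2 add_Suc_right add_0_right)
  also have "\<dots> = - (a2 * (p * h0) + b2 * (p * (c0 / d0) * h1) + c2 * (p * (c0 / d0) * (c1 / d1) * h2)) / d2"
    unfolding step pn by (simp only: p_def h0_def h1_def h2_def)
  also have "\<dots> = p * (c0 / d0) * (c1 / d1) * (c2 / d2) * H \<sigma> w z (Suc (Suc (Suc k)))"
    unfolding H3 using nz by (simp add: field_simps)
  finally show ?case unfolding pn .
qed simp

section \<open>Green function and variation of constants\<close>

definition green :: "nat \<Rightarrow> nat \<Rightarrow> 'a" where
  "green k j = (\<sigma> ^^ Suc j) (\<gamma> (k - Suc j)) / (\<sigma> ^^ j) d"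

text \<open>Delaying \<gamma> by j + 1 and applying \<sigma>^(j+1) matches the coefficients of the
  recurrence, so \<open>green\<close> solves it in its first argument from index j + 1 on.\<close>

lemma green_residual:
  assumes "j < k"
  shows "residual (\<lambda>i. green i j) k = 0"
proof -
  obtain m where k: "k = Suc j + m" using assms by (metis less_iff_Suc_add add_Suc)
  have "residual (\<lambda>i. green i j) k = (\<sigma> ^^ Suc j) (residual \<gamma> m) / (\<sigma> ^^ j) d"
    unfolding residual_def green_def k
    by (simp add: sp_simps add_divide_distrib Suc_diff_le del: sol.simps funpow.simps)
  then show ?thesis by (simp add: residual_sol)
qed

text \<open>The Green sum has zero initial values and the same residual as \<open>u\<close>, so
  subtracting it leaves a solution of the homogeneous recurrence.\<close>

lemma variation_of_constants:
  "u k = u 0 * \<alpha> k + u (Suc 0) * \<beta> k + u (Suc (Suc 0)) * \<gamma> k + (\<Sum>j<k. green k j * residual u j)"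
proof -
  define S where "S k = (\<Sum>j<k. green k j * residual u j)" for k
  have "residual S k = residual u k" for k
  proof -
    \<comment> \<open>Since \<gamma> vanishes at 0 and 1, the extra summands drop out; only at k + 3
      does j = k contribute, through \<gamma> at 2, which is 1.\<close>
    have S: "S (Suc k) = (\<Sum>j<k. green (Suc k) j * residual u j)"
      "S (Suc (Suc k)) = (\<Sum>j<k. green (Suc (Suc k)) j * residual u j)"
      "S (Suc (Suc (Suc k))) = (\<Sum>j<k. green (Suc (Suc (Suc k))) j * residual u j)
          + residual u k / (\<sigma> ^^ k) d"
      by (simp_all add: S_def green_def numeral_2_eq_2 del: funpow.simps)
    have "residual S k = (\<Sum>j<k. residual (\<lambda>i. green i j) k * residual u j) + residual u k"
      unfolding residual_def[of S] S
      by (simp add: S_def residual_def[of "\<lambda>i. green i _"] algebra_simps sum.distrib sum_distrib_left)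
    also have "(\<Sum>j<k. residual (\<lambda>i. green i j) k * residual u j) = 0"
      by (intro sum.neutral) (simp add: green_residual)
    finally show ?thesis by simp
  qed
  moreover have "residual (\<lambda>k. u k - S k) k = residual u k - residual S k" for k
    by (simp add: residual_def algebra_simps)
  ultimately have "residual (\<lambda>k. u k - S k) k = 0" for k by simp
  from residual_0_imp_eq[OF this, of k]
  have "u k - S k = u 0 * \<alpha> k + u (Suc 0) * \<beta> k + u (Suc (Suc 0)) * \<gamma> k"
    by (simp add: S_def green_def)
  then show ?thesis by (simp add: S_def diff_eq_eq)
qed

section \<open>Twisting by \<rho>, and the passage from roots to kernels\<close>

definition twisted_powers :: "'a \<Rightarrow> 'a \<Rightarrow> nat \<Rightarrow> 'a" where
  "twisted_powers \<rho> x k = partial_norm \<rho> k * (\<sigma> ^^ k) x"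

text \<open>This is L with the map sending x to \<open>\<rho> * \<sigma> x\<close> in place of
  \<sigma>; \<open>twisted_powers \<rho> x k\<close> is the k-th iterate of that map at x.\<close>

definition twisted_L :: "'a \<Rightarrow> 'a \<Rightarrow> 'a" where
  "twisted_L \<rho> x = residual (twisted_powers \<rho> x) 0"

lemma twisted_L_eq:
  "twisted_L \<rho> x = a * x + b * (\<rho> * \<sigma> x) + c * (\<rho> * \<sigma> \<rho> * \<sigma> (\<sigma> x))
    + d * (\<rho> * \<sigma> \<rho> * \<sigma> (\<sigma> \<rho>) * \<sigma> (\<sigma> (\<sigma> x)))"
  by (simp add: twisted_L_def residual_def twisted_powers_def partial_norm_Suc)

text \<open>The residuals are the twisted powers of \<open>twisted_L \<rho> x\<close>, so they all
  vanish as soon as the one at index 0 does.\<close>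

lemma residual_twisted_powers:
  "residual (twisted_powers \<rho> x) k = partial_norm \<rho> k * (\<sigma> ^^ k) (twisted_L \<rho> x)"
  by (simp add: residual_def twisted_powers_def twisted_L_eq partial_norm_Suc sp_simps
      funpow_swap1 algebra_simps)

lemma twisted_L_add: "twisted_L \<rho> (x + y) = twisted_L \<rho> x + twisted_L \<rho> y"
  and twisted_L_scale: "k \<in> K \<Longrightarrow> twisted_L \<rho> (k * x) = k * twisted_L \<rho> x"
  by (simp_all add: twisted_L_eq s_simps fixed[THEN iffD2] algebra_simps)

lemma P_L_quotient:
  "x \<noteq> 0 \<Longrightarrow> P_L \<sigma> a b c d (\<rho> * (\<sigma> x / x)) = twisted_L \<rho> x / x"
  by (simp add: P_L_def twisted_L_eq s_simps numeral_2_eq_2 field_simps)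

text \<open>The twisted powers of 1 by \<open>y\<close> are the partial norms of \<open>y\<close>.
  At a root they solve the recurrence, with initial values 1, \<open>y\<close> and
  \<open>y * \<sigma> y\<close>.\<close>

lemma partial_norm_root:
  assumes "P_L \<sigma> a b c d y = 0"
  shows "partial_norm y k = \<alpha> k + \<beta> k * y + \<gamma> k * (y * \<sigma> y)"
proof -
  have "twisted_L y 1 = 0" using P_L_quotient[of 1 y] assms by (simp add: one)
  then have "residual (twisted_powers y 1) k = 0" for k by (simp add: residual_twisted_powers)
  from residual_0_imp_eq[OF this, of k] show ?thesis
    by (simp add: twisted_powers_def partial_norm_Suc one mult_ac)
qed

lemma root_nonzero: "P_L \<sigma> a b c d y = 0 \<Longrightarrow> y \<noteq> 0"
  by (auto simp: P_L_def)

section \<open>From the number of roots to the conditions on \<gamma>\<close>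

text \<open>By Hilbert 90 all elements of a given norm are the \<open>\<rho> \<sigma>(x) / x\<close>, which turns
  \<open>e0 + e1 y + e2 y \<sigma>(y)\<close> into a \<open>\<sigma>\<close>-polynomial of \<open>\<sigma>\<close>-degree two in \<open>x\<close>.\<close>

lemma many_zeros_imp_trivial:
  assumes S: "card S \<ge> q + 2" and norm: "\<And>y. y \<in> S \<Longrightarrow> partial_norm y n = \<kappa>" and "\<kappa> \<noteq> 0"
    and zero: "\<And>y. y \<in> S \<Longrightarrow> e0 + e1 * y + e2 * (y * \<sigma> y) = 0"
  shows "e0 = 0 \<and> e1 = 0 \<and> e2 = 0"
proof (rule ccontr)
  assume nontriv: "\<not> (e0 = 0 \<and> e1 = 0 \<and> e2 = 0)"
  have "S \<noteq> {}" using S by auto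
  then obtain \<rho> where \<rho>S: "\<rho> \<in> S" by auto
  have nz: "y \<noteq> 0" if "y \<in> S" for y using norm[OF that] \<open>\<kappa> \<noteq> 0\<close> n_pos by auto
  note \<rho> = nz[OF \<rho>S]
  define V where "V = {x. x \<noteq> 0 \<and> \<rho> * (\<sigma> x / x) \<in> S}"
  have "(\<lambda>x. \<rho> * (\<sigma> x / x)) ` V = S"
  proof (intro equalityI subsetI)
    fix y assume y: "y \<in> S"
    have "partial_norm (y / \<rho>) n = 1"
      using norm[OF y] norm[OF \<rho>S] \<open>\<kappa> \<noteq> 0\<close> by (simp add: partial_norm_divide)
    then obtain x where "x \<noteq> 0" "\<sigma> x / x = y / \<rho>" using hilbert_90 by blast
    then have "y = \<rho> * (\<sigma> x / x)" using \<rho> by simp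
    then show "y \<in> (\<lambda>x. \<rho> * (\<sigma> x / x)) ` V" using y \<open>x \<noteq> 0\<close> by (auto simp: V_def)
  qed (auto simp: V_def)
  moreover have "card V = card ((\<lambda>x. \<rho> * (\<sigma> x / x)) ` V) * (q - 1)"
    by (rule card_quotient_image) (use \<rho> in \<open>auto simp: V_def s_simps fixed[THEN iffD2]\<close>)
  ultimately have "card V = card S * (q - 1)" by simp
  then have "card V \<ge> (q + 2) * (q - 1)"
    using mult_le_mono1[OF S] by simp
  \<comment> \<open>This is where q + 2 comes from: with q + 1 elements the left side would be
    exactly q^2, which is no contradiction.\<close>
  moreover have "(q + 2) * (q - 1) + 1 > q ^ 2"
  proof -
    obtain r where "q = r + 2" using q_ge_2 by (metis le_add_diff_inverse2)
    then show ?thesis by (simp add: power2_eq_square algebra_simps)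
  qed
  ultimately have big: "card (insert 0 V) > q ^ 2"
    by (simp add: V_def)
  define f where "f i = (if i = 0 then e0 else if i = 1 then e1 * \<rho> else e2 * (\<rho> * \<sigma> \<rho>))" for i :: nat
  have "insert 0 V \<subseteq> {x. (\<Sum>i\<le>2. f i * (\<sigma> ^^ i) x) = 0}"
  proof
    fix x assume "x \<in> insert 0 V"
    have "x \<noteq> 0 \<Longrightarrow> e0 + e1 * (\<rho> * (\<sigma> x / x)) + e2 * (\<rho> * (\<sigma> x / x) * \<sigma> (\<rho> * (\<sigma> x / x))) = 0"
      using zero \<open>x \<in> insert 0 V\<close> unfolding V_def by blast
    moreover have "e0 * x + e1 * (\<rho> * \<sigma> x) + e2 * (\<rho> * \<sigma> \<rho> * \<sigma> (\<sigma> x)) =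
        x * (e0 + e1 * (\<rho> * (\<sigma> x / x)) + e2 * (\<rho> * (\<sigma> x / x) * \<sigma> (\<rho> * (\<sigma> x / x))))" if "x \<noteq> 0"
      using that by (simp add: s_simps field_simps)
    ultimately have "e0 * x + e1 * (\<rho> * \<sigma> x) + e2 * (\<rho> * \<sigma> \<rho> * \<sigma> (\<sigma> x)) = 0"
      by (cases "x = 0") (simp_all only: mult_zero_right s_zero add_0_right simp_thms)
    then show "x \<in> {x. (\<Sum>i\<le>2. f i * (\<sigma> ^^ i) x) = 0}"
      by (simp add: numeral_2_eq_2 f_def mult_ac)
  qed
  then have "card (insert 0 V) \<le> card {x. (\<Sum>i\<le>2. f i * (\<sigma> ^^ i) x) = 0}"
    by (intro card_mono) simp_all
  also have "\<dots> \<le> q ^ 2"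
  proof -
    have "f 0 \<noteq> 0 \<or> f 1 \<noteq> 0 \<or> f 2 \<noteq> 0" using nontriv \<rho> by (auto simp: f_def)
    then obtain i where "i \<le> 2" "f i \<noteq> 0" using zero_le[of 2] one_le_numeral order_refl by blast
    then show ?thesis by (rule card_kernel_le_nontrivial)
  qed
  finally show False using big by simp
qed

lemma max_roots_imp_gamma:
  assumes "card {y. P_L \<sigma> a b c d y = 0} = q ^ 2 + q + 1"
  shows "\<gamma> n = 0 \<and> \<gamma> (Suc n) = 0 \<and> \<gamma> (Suc (Suc n)) \<in> K"
proof -
  let ?R = "{y. P_L \<sigma> a b c d y = 0}"
  \<comment> \<open>Pigeonhole: q - 1 norm values, each taken at most q + 1 times, would give at
    most q^2 - 1 roots.\<close>
  have "\<exists>\<kappa>\<in>K - {0}. card {y \<in> ?R. partial_norm y n = \<kappa>} \<ge> q + 2"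
  proof (rule ccontr)
    assume "\<not> ?thesis"
    then have *: "card {y \<in> ?R. partial_norm y n = \<kappa>} < q + 2" if "\<kappa> \<in> K - {0}" for \<kappa>
      using that by (meson not_le)
    have "card ?R \<le> card (K - {0}) * (q + 1)"
      by (rule card_le_fibres[where f = "\<lambda>y. partial_norm y n"])
        (use * norm_in_K root_nonzero in \<open>auto simp: less_Suc_eq_le\<close>)
    also have "\<dots> = (q - 1) * (q + 1)" by (simp add: card_K zero_in_K)
    also have "\<dots> \<le> q * (q + 1)" by (rule mult_le_mono1) simp
    finally show False using assms by (simp add: power2_eq_square)
  qed
  then obtain \<kappa> where \<kappa>: "\<kappa> \<in> K" "\<kappa> \<noteq> 0" and S: "card {y \<in> ?R. partial_norm y n = \<kappa>} \<ge> q + 2"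
    by blast
  note trivial = many_zeros_imp_trivial[OF S _ \<kappa>(2)]
  \<comment> \<open>Since \<sigma>^n is the identity, the two factors after the full norm are again
    \<open>y\<close> and \<open>\<sigma> y\<close>.\<close>
  have pn: "partial_norm y n = \<alpha> n + \<beta> n * y + \<gamma> n * (y * \<sigma> y)"
    "partial_norm y n * y = \<alpha> (Suc n) + \<beta> (Suc n) * y + \<gamma> (Suc n) * (y * \<sigma> y)"
    "partial_norm y n * (y * \<sigma> y) = \<alpha> (Suc (Suc n)) + \<beta> (Suc (Suc n)) * y + \<gamma> (Suc (Suc n)) * (y * \<sigma> y)"
    if "P_L \<sigma> a b c d y = 0" for y
    unfolding partial_norm_root[OF that, symmetric]
    by (simp_all add: partial_norm_Suc funpow_n)
  have "(\<alpha> n - \<kappa>) + \<beta> n * y + \<gamma> n * (y * \<sigma> y) = 0"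
    "\<alpha> (Suc n) + (\<beta> (Suc n) - \<kappa>) * y + \<gamma> (Suc n) * (y * \<sigma> y) = 0"
    "\<alpha> (Suc (Suc n)) + \<beta> (Suc (Suc n)) * y + (\<gamma> (Suc (Suc n)) - \<kappa>) * (y * \<sigma> y) = 0"
    if "y \<in> {y \<in> ?R. partial_norm y n = \<kappa>}" for y
    using pn[of y] that by (simp_all add: left_diff_distrib)
  note trivial[OF _ this(1)] trivial[OF _ this(2)] trivial[OF _ this(3)]
  then have "\<gamma> n = 0" "\<gamma> (Suc n) = 0" "\<gamma> (Suc (Suc n)) - \<kappa> = 0"
    by blast+
  then show ?thesis using \<kappa>(1) by simp
qed

section \<open>From the conditions on \<gamma> to the number of roots\<close>

lemma card_kernel_twisted_L:
  assumes n: "n \<ge> 3" and \<rho>: "\<rho> \<noteq> 0"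
    and norm: "\<alpha> n = partial_norm \<rho> n" "\<beta> n = 0" "\<gamma> n = 0"
  shows "card {x. twisted_L \<rho> x = 0} = q ^ 3"
proof (rule antisym)
  define f where "f i = (if i = 0 then a else if i = 1 then b * \<rho> else if i = 2 then c * (\<rho> * \<sigma> \<rho>)
      else d * (\<rho> * \<sigma> \<rho> * \<sigma> (\<sigma> \<rho>)))" for i :: nat
  have "twisted_L \<rho> x = (\<Sum>i\<le>3. f i * (\<sigma> ^^ i) x)" for x
    by (simp add: twisted_L_eq f_def numeral_3_eq_3 mult_ac)
  moreover have "f 3 \<noteq> 0" using \<rho> by (simp add: f_def)
  ultimately show "card {x. twisted_L \<rho> x = 0} \<le> q ^ 3"
    using card_kernel_le[of f 3] by simp
next
  obtain m where m: "n = Suc (Suc (Suc m))"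
    using n that[of "n - 3"] by simp
  let ?Z = "{y. (\<Sum>j\<le>m. (green n j * partial_norm \<rho> j) * (\<sigma> ^^ j) y) = 0}"
  have "twisted_L \<rho> x \<in> ?Z" for x
  proof -
    \<comment> \<open>At index n the sequence returns to \<open>\<alpha> n * x\<close>, which the
      homogeneous part already accounts for, so the Green sum vanishes.\<close>
    have "(\<Sum>j<n. green n j * residual (twisted_powers \<rho> x) j) = 0"
      using variation_of_constants[of "twisted_powers \<rho> x" n] norm
      by (simp add: twisted_powers_def funpow_n mult.commute)
    \<comment> \<open>The last two terms contain \<gamma> at 1 and 0. The new top index is m = n -
      3, whose coefficient is nonzero because \<gamma> at 2 is 1.\<close>
    moreover have "green n (Suc m) = 0" "green n (Suc (Suc m)) = 0"
      by (simp_all add: green_def m)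
    ultimately have "(\<Sum>j<Suc m. green n j * residual (twisted_powers \<rho> x) j) = 0"
      unfolding m by simp
    then show ?thesis
      by (simp add: lessThan_Suc_atMost residual_twisted_powers mult.assoc)
  qed
  \<comment> \<open>The image of the twisted L lies in a kernel of size at most q^(n-3), and each
    fibre is at most as large as its own kernel.\<close>
  then have "card (UNIV :: 'a set) \<le> card ?Z * card {x. twisted_L \<rho> x = 0}"
  proof (intro card_le_fibres[where f = "twisted_L \<rho>"])
    fix y
    show "card {x \<in> UNIV. twisted_L \<rho> x = y} \<le> card {x. twisted_L \<rho> x = 0}"
    proof (cases "\<exists>x0. twisted_L \<rho> x0 = y")
      case True
      then obtain x0 where x0: "twisted_L \<rho> x0 = y" by auto
      have "{x. twisted_L \<rho> x = y} \<subseteq> (+) x0 ` {x. twisted_L \<rho> x = 0}"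
      proof
        fix x assume "x \<in> {x. twisted_L \<rho> x = y}"
        then have "twisted_L \<rho> (x - x0) = 0"
          using twisted_L_add[of \<rho> "x - x0" x0] x0 by simp
        then show "x \<in> (+) x0 ` {x. twisted_L \<rho> x = 0}"
          by (intro image_eqI[of _ _ "x - x0"]) simp_all
      qed
      then have "card {x. twisted_L \<rho> x = y} \<le> card ((+) x0 ` {x. twisted_L \<rho> x = 0})"
        by (intro card_mono) simp_all
      then show ?thesis by (simp add: card_image)
    qed simp
  qed auto
  also have "card ?Z \<le> q ^ m"
    by (rule card_kernel_le) (simp add: green_def m \<rho> numeral_2_eq_2)
  finally have "q ^ m * q ^ 3 \<le> q ^ m * card {x. twisted_L \<rho> x = 0}"
    by (simp add: card_UNIV m power_add[symmetric] eval_nat_numeral)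
  then show "q ^ 3 \<le> card {x. twisted_L \<rho> x = 0}"
    using q_ge_2 by simp
qed

lemma gamma_imp_max_roots:
  assumes n: "n \<ge> 3" and \<gamma>: "\<gamma> n = 0" "\<gamma> (Suc n) = 0" "\<gamma> (Suc (Suc n)) \<in> K"
  shows "card {y. P_L \<sigma> a b c d y = 0} = q ^ 2 + q + 1"
proof -
  define \<kappa> where "\<kappa> = \<gamma> (Suc (Suc n))"
  have \<kappa>: "\<kappa> \<in> K" "\<kappa> \<noteq> 0" using \<gamma> gamma_no_three_zeros[of n] by (simp_all add: \<kappa>_def del: sol.simps)
  have s_inj: "x = y" if "\<sigma> x = \<sigma> y" for x y
    using s_eq_0_iff[of "x - y"] that by (simp add: s_simps del: s_eq_0_iff)
  \<comment> \<open>The shift identities are read backwards, from \<gamma> at n + 1 and n + 2 to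
    \<beta> at n and n + 1, then to \<alpha> at n. As \<kappa> lies in \<open>K\<close>, undoing
    \<sigma> leaves it unchanged.\<close>
  have \<beta>: "\<beta> n = 0" using gamma_shift[of n] \<gamma> by simp
  have "\<sigma> (\<beta> (Suc n)) = \<sigma> \<kappa>"
    using gamma_shift[of "Suc n"] \<gamma>(2) \<kappa>(1) by (simp add: \<kappa>_def[symmetric] fixed[THEN iffD2] del: sol.simps)
  then have "\<beta> (Suc n) = \<sigma> \<kappa>" using s_inj \<kappa>(1) fixed by metis
  then have \<alpha>: "\<alpha> n = \<kappa>"
    using beta_shift[of n] \<gamma>(1) s_inj by (simp del: sol.simps)
  obtain \<rho> where \<rho>: "\<rho> \<noteq> 0" "partial_norm \<rho> n = \<kappa>" using norm_surj[OF \<kappa>] .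
  let ?A = "{x. twisted_L \<rho> x = 0} - {0}" and ?R = "{y. P_L \<sigma> a b c d y = 0}"
  have "(\<lambda>x. \<rho> * (\<sigma> x / x)) ` ?A = ?R"
  proof (intro equalityI subsetI)
    fix y assume "y \<in> ?R"
    then have y: "P_L \<sigma> a b c d y = 0" by simp
    \<comment> \<open>As \<beta> and \<gamma> vanish at n, every root has norm \<kappa>, so a single
      \<rho> reaches all roots.\<close>
    have "partial_norm (y / \<rho>) n = 1"
      using partial_norm_root[OF y, of n] \<alpha> \<beta> \<gamma>(1) \<rho>(2) \<kappa>(2) by (simp add: partial_norm_divide)
    then obtain x where x: "x \<noteq> 0" "\<sigma> x / x = y / \<rho>" using hilbert_90 by blast
    then have yx: "y = \<rho> * (\<sigma> x / x)" using \<rho>(1) by simp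
    then have "twisted_L \<rho> x = 0" using P_L_quotient[OF x(1), of \<rho>] y x(1) by simp
    then show "y \<in> (\<lambda>x. \<rho> * (\<sigma> x / x)) ` ?A" using x(1) yx by auto
  next
    fix y assume "y \<in> (\<lambda>x. \<rho> * (\<sigma> x / x)) ` ?A"
    then obtain x where "x \<noteq> 0" "twisted_L \<rho> x = 0" "y = \<rho> * (\<sigma> x / x)" by blast
    then show "y \<in> ?R" using P_L_quotient[of x \<rho>] by simp
  qed
  moreover have "card ?A = card ((\<lambda>x. \<rho> * (\<sigma> x / x)) ` ?A) * (q - 1)"
    by (rule card_quotient_image) (use \<rho>(1) in \<open>auto simp: twisted_L_scale\<close>)
  moreover have "0 \<in> {x. twisted_L \<rho> x = 0}" by (simp add: twisted_L_eq)
  then have "card ?A = q ^ 3 - 1"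
    using card_kernel_twisted_L[OF n \<rho>(1)] \<alpha> \<beta> \<gamma>(1) \<rho>(2) by simp
  ultimately have eq: "card ?R * (q - 1) = q ^ 3 - 1" by simp
  obtain r where r: "q = r + 2" using q_ge_2 by (metis le_add_diff_inverse2)
  have "q ^ 3 - 1 = (q ^ 2 + q + 1) * (q - 1)"
    by (simp add: r eval_nat_numeral algebra_simps)
  with eq have "card ?R * (q - 1) = (q ^ 2 + q + 1) * (q - 1)" by simp
  then show ?thesis using q_ge_2 by (simp only: mult_cancel2) simp
qed

text \<open>The indices of \<gamma> and \<open>H\<close> differ by two, and the factor between
  \<gamma> at n + 2 and \<open>H\<close> at n is the full norm of \<open>c / d\<close>, a nonzero
  element of \<open>K\<close>, so membership in \<open>K\<close> transfers.\<close>

lemma max_roots_iff: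
  assumes n: "n \<ge> 3" and w: "w = w_param \<sigma> a b c" and z: "z = z_param \<sigma> b c d"
  shows "card {y. P_L \<sigma> a b c d y = 0} = q ^ 2 + q + 1 \<longleftrightarrow>
    H \<sigma> w z (n - 1) = 0 \<and> H \<sigma> w z (n - 2) = 0 \<and> H \<sigma> w z n \<in> K"
proof -
  obtain m where m: "n = Suc (Suc m)" using n by (metis add_2_eq_Suc le_Suc_ex numeral_3_eq_3 numeral_2_eq_2 add_Suc_shift)
  note gH = gamma_eq_H[OF w z]
  have "partial_norm (c / d) k \<noteq> 0" for k by simp
  then have "\<gamma> n = 0 \<longleftrightarrow> H \<sigma> w z (n - 2) = 0" "\<gamma> (Suc n) = 0 \<longleftrightarrow> H \<sigma> w z (n - 1) = 0"
    using gH[of m] gH[of "Suc m"] by (simp_all add: m del: sol.simps H.simps)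
  moreover have "\<gamma> (Suc (Suc n)) \<in> K \<longleftrightarrow> H \<sigma> w z n \<in> K"
  proof -
    let ?N = "partial_norm (c / d) n"
    have N: "?N \<noteq> 0" "?N \<in> K" by (simp_all add: norm_in_K)
    have "H \<sigma> w z n = \<gamma> (Suc (Suc n)) / ?N" using N(1) gH[of n] by (simp del: sol.simps)
    then show ?thesis using N(2) gH[of n] K_mult K_divide by metis
  qed
  ultimately show ?thesis
    using max_roots_imp_gamma gamma_imp_max_roots[OF n] by blast
qed

end

theorem theorem12:
  fixes q n :: nat
    and K :: "'a::{field,finite} set"
    and \<sigma> :: "'a \<Rightarrow> 'a"
    and a b c d w z :: 'a
  assumes "primepow q" and "n \<ge> 3"
    and "card (UNIV :: 'a set) = q ^ n"
    and "subfield K ring_of_type_algebra" and "card K = q"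
    and "galois_generator K \<sigma>"
    and "a * b * c * d \<noteq> 0"
    and "w = w_param \<sigma> a b c" and "z = z_param \<sigma> b c d"
  shows "card {y. P_L \<sigma> a b c d y = 0} = q ^ 2 + q + 1 \<longleftrightarrow>
    H \<sigma> w z (n - 1) = 0 \<and> H \<sigma> w z (n - 2) = 0 \<and> H \<sigma> w z n \<in> K"
proof -
  interpret cyclic_extension \<sigma> K q n
    by (rule cyclic_extension_of_galois_generator) fact+
  interpret cubic_sigma_polynomial \<sigma> K q n a b c d
    by unfold_locales (use assms(7) in auto)
  show ?thesis by (rule max_roots_iff) fact+
qed

end
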